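(* Let $K$ be a field and let $r_1\ge r_2\ge\cdots\ge r_n\ge 2$ be integers satisfying one of the following conditions: (a) $n\ge 4$ and $r_3\ge 3$; (b) $n=3$ and $r_3\ge 4$; (c) $n=3$, $r_3=3$, $r_1\ge 6$ and $r_2\ge 4$. Then the configuration $A_{r_1r_2\cdots r_n}$ of the no $n$-way interaction model for $r_1\times r_2\times\cdots\times r_n$ contingency tables is not very ample, i.e. $K[A_{r_1r_2\cdots r_n}]$ is not very ample.
   Context: Write $[r]=\{1,2,\dots,r\}$. For integers $r_1\ge\cdots\ge r_n\ge 2$ put $d_k=\frac{\prod_{\ell=1}^n r_\ell}{r_k}$ for $1\le k\le n$, and index the coordinates of $\mathbb Z^{d_k}$ by the tuples $(i_1,\dots,i_{k-1},i_{k+1},\dots,i_n)$ with $i_j\in[r_j]$; let $\mathbf e^{(k)}_{i_1\cdots i_{k-1}i_{k+1}\cdots i_n}$ be the corresponding unit coordinate vector of $\mathbb Z^{d_k}$. The configuration $A_{r_1r_2\cdots r_n}\subset\mathbb Z_{\ge 0}^{d_1+\cdots+d_n}$ is the set of all vectors $$\mathbf e^{(1)}_{i_2i_3\cdots i_n}\oplus\mathbf e^{(2)}_{i_1i_3\cdots i_n}\oplus\cdots\oplus\mathbf e^{(n)}_{i_1i_2\cdots i_{n-1}},\qquad i_k\in[r_k]\ (1\le k\le n).$$ For a finite set $A=\{\mathbf a_1,\dots,\mathbf a_m\}\subset\mathbb Z_{\ge 0}^d$, the semigroup ring is $K[A]=K[\mathbf t^{\mathbf a_1},\dots,\mathbf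 t^{\mathbf a_m}]\subset K[t_1,\dots,t_d]$, where $\mathbf t^{\mathbf a}=t_1^{a_1}\cdots t_d^{a_d}$. $\mathbb Z_{\ge 0}A$, $\mathbb ZA$, $\mathbb Q_{\ge 0}A$ denote the sets of linear combinations of elements of $A$ with coefficients in $\mathbb Z_{\ge 0}$, $\mathbb Z$, $\mathbb Q_{\ge 0}$ respectively. $K[A]$ (or $A$) is very ample if $(\mathbb ZA\cap\mathbb Q_{\ge 0}A)\setminus\mathbb Z_{\ge 0}A$ is a finite (or empty) set. *)

theory Defs
  imports Complex_Main "HOL-Library.Poly_Mapping" "HOL-Library.FuncSet"
begin

text \<open>
  A vector of \<open>\<int>\<^sub>\<ge>\<^sub>0\<^sup>d\<close> is a finitely supported function \<open>'v \<Rightarrow>\<^sub>0 nat\<close>, so that it is at the same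
  time an exponent vector of the polynomial ring \<open>('v \<Rightarrow>\<^sub>0 nat) \<Rightarrow>\<^sub>0 'k\<close>. The type \<open>'v\<close> may
  contain more coordinates than the \<open>d\<close> in use; all vectors considered vanish there, and neither
  the spans nor the semigroup ring depend on the additional coordinates.

  The three spans are all taken in the common ambient space \<open>'v \<Rightarrow> rat\<close>. They are meant for
  finite \<open>A\<close>.
\<close>

definition nat_span :: "('v \<Rightarrow>\<^sub>0 nat) set \<Rightarrow> ('v \<Rightarrow> rat) set" where
  "nat_span A =
     {x. \<exists>c :: ('v \<Rightarrow>\<^sub>0 nat) \<Rightarrow> nat. x = (\<lambda>v. \<Sum>a\<in>A. of_nat (c a) * of_nat (Poly_Mapping.lookup a v))}"

definition int_span :: "('v \<Rightarrow>\<^sub>0 nat) set \<Rightarrow> ('v \<Rightarrow> rat) set" where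
  "int_span A =
     {x. \<exists>c :: ('v \<Rightarrow>\<^sub>0 nat) \<Rightarrow> int. x = (\<lambda>v. \<Sum>a\<in>A. of_int (c a) * of_nat (Poly_Mapping.lookup a v))}"

definition rat_cone :: "('v \<Rightarrow>\<^sub>0 nat) set \<Rightarrow> ('v \<Rightarrow> rat) set" where
  "rat_cone A =
     {x. \<exists>c :: ('v \<Rightarrow>\<^sub>0 nat) \<Rightarrow> rat. (\<forall>a\<in>A. 0 \<le> c a) \<and>
           x = (\<lambda>v. \<Sum>a\<in>A. c a * of_nat (Poly_Mapping.lookup a v))}"

definition very_ample :: "('v \<Rightarrow>\<^sub>0 nat) set \<Rightarrow> bool" where
  "very_ample A \<longleftrightarrow> finite ((int_span A \<inter> rat_cone A) - nat_span A)"

text \<open>The \<open>K\<close>-subalgebra of the polynomial ring generated by the monomials with exponents in \<open>A\<close>.\<close>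

inductive_set semigroup_ring ::
  "('v \<Rightarrow>\<^sub>0 nat) set \<Rightarrow> (('v \<Rightarrow>\<^sub>0 nat) \<Rightarrow>\<^sub>0 'k::field) set"
  for A where
  scalar: "Poly_Mapping.single 0 c \<in> semigroup_ring A"
| generator: "a \<in> A \<Longrightarrow> Poly_Mapping.single a 1 \<in> semigroup_ring A"
| add: "p \<in> semigroup_ring A \<Longrightarrow> q \<in> semigroup_ring A \<Longrightarrow> p + q \<in> semigroup_ring A"
| mult: "p \<in> semigroup_ring A \<Longrightarrow> q \<in> semigroup_ring A \<Longrightarrow> p * q \<in> semigroup_ring A"

text \<open>
  Very ampleness of a semigroup ring is that of a finite configuration generating it. The choice
  of the configuration does not matter: see \<open>very_ample_ring_semigroup_ring\<close> below.
\<close>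

definition very_ample_ring :: "(('v \<Rightarrow>\<^sub>0 nat) \<Rightarrow>\<^sub>0 'k::field) set \<Rightarrow> bool" where
  "very_ample_ring R \<longleftrightarrow> (\<exists>A. finite A \<and> R = semigroup_ring A \<and> very_ample A)"

text \<open>
  The coordinate \<open>(i\<^sub>1, \<dots>, i\<^sub>k\<^sub>-\<^sub>1, i\<^sub>k\<^sub>+\<^sub>1, \<dots>, i\<^sub>n)\<close> of the \<open>k\<close>-th summand \<open>\<int>\<^bsup>d_k\<^esup>\<close> is
  encoded as the pair of \<open>k\<close> and the restriction of \<open>i\<close> to \<open>{1..n} - {k}\<close>; tagging
  with \<open>k\<close> turns the direct sum into an ordinary sum.
\<close>

definition unit_vec :: "nat \<Rightarrow> nat \<Rightarrow> (nat \<Rightarrow> nat) \<Rightarrow> (nat \<times> (nat \<Rightarrow> nat)) \<Rightarrow>\<^sub>0 nat" where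
  "unit_vec n k i = Poly_Mapping.single (k, restrict i ({1..n} - {k})) 1"

definition no_way_config :: "nat \<Rightarrow> (nat \<Rightarrow> nat) \<Rightarrow> ((nat \<times> (nat \<Rightarrow> nat)) \<Rightarrow>\<^sub>0 nat) set" where
  "no_way_config n r =
     {\<Sum>k = 1..n. unit_vec n k i | i. i \<in> (\<Pi>\<^sub>E k\<in>{1..n}. {1..r k})}"

lemma nat_spanI:
  "x = (\<lambda>v. \<Sum>a\<in>A. of_nat (c a) * of_nat (Poly_Mapping.lookup a v)) \<Longrightarrow> x \<in> nat_span A"
  unfolding nat_span_def by (intro CollectI exI[of _ c])

lemma int_spanI:
  "x = (\<lambda>v. \<Sum>a\<in>A. of_int (c a) * of_nat (Poly_Mapping.lookup a v)) \<Longrightarrow> x \<in> int_span A"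
  unfolding int_span_def by (intro CollectI exI[of _ c])

lemma nat_span_0: "(\<lambda>v. 0) \<in> nat_span A"
  unfolding nat_span_def by (rule CollectI, rule exI[of _ "\<lambda>_. 0"]) simp

lemma nat_span_base:
  assumes "finite A" "a \<in> A"
  shows "(\<lambda>v. of_nat (Poly_Mapping.lookup a v)) \<in> nat_span A"
proof -
  have "of_nat (Poly_Mapping.lookup a v) =
      (\<Sum>b\<in>A. of_nat (if b = a then 1 else 0) * (of_nat (Poly_Mapping.lookup b v) :: rat))" for v
    using assms by (subst sum.remove[of A a]) (auto intro!: sum.neutral)
  then show ?thesis by (intro nat_spanI[where c = "\<lambda>b. if b = a then 1 else 0"]) (rule ext)
qed

lemma nat_span_add:
  assumes "x \<in> nat_span A" "y \<in> nat_span A"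
  shows "(\<lambda>v. x v + y v) \<in> nat_span A"
proof -
  from assms obtain c d :: "_ \<Rightarrow> nat" where
    "x = (\<lambda>v. \<Sum>a\<in>A. of_nat (c a) * of_nat (Poly_Mapping.lookup a v))"
    "y = (\<lambda>v. \<Sum>a\<in>A. of_nat (d a) * of_nat (Poly_Mapping.lookup a v))"
    unfolding nat_span_def by blast
  then have "(\<lambda>v. x v + y v) = (\<lambda>v. \<Sum>a\<in>A. of_nat (c a + d a) * of_nat (Poly_Mapping.lookup a v))"
    by (simp add: algebra_simps sum.distrib)
  then show ?thesis by (rule nat_spanI)
qed

lemma keys_semigroup_ring:
  assumes "finite A" "p \<in> semigroup_ring A" "m \<in> Poly_Mapping.keys p"
  shows "(\<lambda>v. of_nat (Poly_Mapping.lookup m v)) \<in> nat_span A"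
  using assms(2,3)
proof (induction arbitrary: m)
  case (scalar c)
  then show ?case using nat_span_0 by (auto split: if_splits)
next
  case (generator a)
  then show ?case using nat_span_base[OF assms(1)] by auto
next
  case (add p q)
  then show ?case using Poly_Mapping.keys_add[of p q] by auto
next
  case (mult p q)
  then obtain a b where "m = a + b" "a \<in> Poly_Mapping.keys p" "b \<in> Poly_Mapping.keys q"
    using Poly_Mapping.keys_mult[of p q] by blast
  then show ?case using mult.IH nat_span_add by (fastforce simp: Poly_Mapping.lookup_add)
qed

lemma semigroup_ring_generators:
  assumes "finite A" "(semigroup_ring A :: (_ \<Rightarrow>\<^sub>0 'k::field) set) = semigroup_ring B" "b \<in> B"
  shows "\<exists>c :: _ \<Rightarrow> nat. \<forall>v. (of_nat (Poly_Mapping.lookup b v) :: rat) =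
           (\<Sum>a\<in>A. of_nat (c a) * of_nat (Poly_Mapping.lookup a v))"
proof -
  have "(Poly_Mapping.single b 1 :: _ \<Rightarrow>\<^sub>0 'k) \<in> semigroup_ring A"
    using assms(2) semigroup_ring.generator[OF assms(3)] by simp
  from keys_semigroup_ring[OF assms(1) this, of b] show ?thesis
    unfolding nat_span_def by (auto simp: fun_eq_iff)
qed

lemma spans_mono:
  assumes "finite A" "finite B"
    and eq: "(semigroup_ring A :: (_ \<Rightarrow>\<^sub>0 'k::field) set) = semigroup_ring B"
  shows "nat_span B \<subseteq> nat_span A" "int_span B \<subseteq> int_span A" "rat_cone B \<subseteq> rat_cone A"
proof -
  have "\<forall>b\<in>B. \<exists>c :: _ \<Rightarrow> nat. \<forall>v. (of_nat (Poly_Mapping.lookup b v) :: rat) =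
           (\<Sum>a\<in>A. of_nat (c a) * of_nat (Poly_Mapping.lookup a v))"
    using semigroup_ring_generators[OF assms(1) eq] by blast
  then obtain m :: "_ \<Rightarrow> _ \<Rightarrow> nat" where m: "\<And>b v. b \<in> B \<Longrightarrow>
      (of_nat (Poly_Mapping.lookup b v) :: rat) = (\<Sum>a\<in>A. of_nat (m b a) * of_nat (Poly_Mapping.lookup a v))"
    by metis
  have expand: "(\<Sum>b\<in>B. f b * of_nat (Poly_Mapping.lookup b v)) =
      (\<Sum>a\<in>A. (\<Sum>b\<in>B. f b * of_nat (m b a)) * of_nat (Poly_Mapping.lookup a v))" for f :: "_ \<Rightarrow> rat" and v
  proof -
    have "(\<Sum>b\<in>B. f b * of_nat (Poly_Mapping.lookup b v)) =
        (\<Sum>b\<in>B. \<Sum>a\<in>A. f b * of_nat (m b a) * of_nat (Poly_Mapping.lookup a v))"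
      by (intro sum.cong) (simp_all add: m sum_distrib_left mult.assoc)
    also have "\<dots> = (\<Sum>a\<in>A. (\<Sum>b\<in>B. f b * of_nat (m b a)) * of_nat (Poly_Mapping.lookup a v))"
      by (subst sum.swap) (simp add: sum_distrib_right)
    finally show ?thesis .
  qed
  show "nat_span B \<subseteq> nat_span A"
  proof
    fix x assume "x \<in> nat_span B"
    then obtain c :: "_ \<Rightarrow> nat" where "x = (\<lambda>v. \<Sum>b\<in>B. of_nat (c b) * of_nat (Poly_Mapping.lookup b v))"
      unfolding nat_span_def by blast
    then have "x = (\<lambda>v. \<Sum>a\<in>A. of_nat (\<Sum>b\<in>B. c b * m b a) * of_nat (Poly_Mapping.lookup a v))"
      by (simp add: expand)
    then show "x \<in> nat_span A" by (rule nat_spanI)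
  qed
  show "int_span B \<subseteq> int_span A"
  proof
    fix x assume "x \<in> int_span B"
    then obtain c :: "_ \<Rightarrow> int" where "x = (\<lambda>v. \<Sum>b\<in>B. of_int (c b) * of_nat (Poly_Mapping.lookup b v))"
      unfolding int_span_def by blast
    then have "x = (\<lambda>v. \<Sum>a\<in>A. of_int (\<Sum>b\<in>B. c b * int (m b a)) * of_nat (Poly_Mapping.lookup a v))"
      by (simp add: expand)
    then show "x \<in> int_span A" by (rule int_spanI)
  qed
  show "rat_cone B \<subseteq> rat_cone A"
  proof
    fix x assume "x \<in> rat_cone B"
    then obtain c :: "_ \<Rightarrow> rat" where c: "\<forall>b\<in>B. 0 \<le> c b"
      and "x = (\<lambda>v. \<Sum>b\<in>B. c b * of_nat (Poly_Mapping.lookup b v))"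
      unfolding rat_cone_def by blast
    then have "x = (\<lambda>v. \<Sum>a\<in>A. (\<Sum>b\<in>B. c b * of_nat (m b a)) * of_nat (Poly_Mapping.lookup a v))"
      by (simp add: expand)
    moreover have "\<forall>a\<in>A. 0 \<le> (\<Sum>b\<in>B. c b * of_nat (m b a))"
      using c by (auto intro!: sum_nonneg)
    ultimately show "x \<in> rat_cone A" unfolding rat_cone_def
      by (intro CollectI exI[of _ "\<lambda>a. \<Sum>b\<in>B. c b * of_nat (m b a)"]) auto
  qed
qed

lemma very_ample_ring_semigroup_ring:
  assumes "finite A"
  shows "very_ample_ring (semigroup_ring A :: (_ \<Rightarrow>\<^sub>0 'k::field) set) \<longleftrightarrow> very_ample A"
proof
  assume "very_ample_ring (semigroup_ring A :: (_ \<Rightarrow>\<^sub>0 'k) set)"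
  then obtain B where B: "finite B" "very_ample B"
    and eq: "(semigroup_ring A :: (_ \<Rightarrow>\<^sub>0 'k) set) = semigroup_ring B"
    unfolding very_ample_ring_def by blast
  have "nat_span A = nat_span B" "int_span A = int_span B" "rat_cone A = rat_cone B"
    using spans_mono[OF assms B(1) eq] spans_mono[OF B(1) assms eq[symmetric]] by blast+
  with B(2) show "very_ample A" unfolding very_ample_def by simp
next
  assume "very_ample A"
  with assms show "very_ample_ring (semigroup_ring A :: (_ \<Rightarrow>\<^sub>0 'k) set)"
    unfolding very_ample_ring_def by blast
qed

end

theory Submission
  imports Defs
begin

text \<open>
  A vector of the configuration is indexed by a cell \<open>i\<close> of an \<open>r\<^sub>1 \<times> \<dots> \<times> r\<^sub>n\<close> table, and a linear
  combination of these vectors is the list of all line sums of the table of its coefficients. So a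
  hole of the semigroup is a list of line sums of a nonnegative rational table that are
  also the line sums of an integer table, but not of a table of natural numbers.

  The holes come from a set \<open>S\<close> of cells that every line meets in an even number of cells. Put
  \<open>1/2\<close> on \<open>S\<close> and \<open>0\<close> elsewhere. The line sums are integers, and integer line sums are always those
  of some integer table (\<open>integral_line_sums_lift\<close>). Suppose that a natural table \<open>U\<close> has the same
  line sums. It vanishes on every line that misses \<open>S\<close>. If it therefore vanishes off \<open>S\<close>, and if the
  lines that meet \<open>S\<close> do so in just two cells, then \<open>U u + U v = 1\<close> for any two cells \<open>u, v\<close> of \<open>S\<close>
  on a common line; a closed walk of odd length in \<open>S\<close> then forces \<open>2 * U u = 1\<close>, which is absurd.
  A natural number \<open>N\<close> can be added at a cell of \<open>S\<close> that lies on none of the lines of the walk: the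
  argument does not change, and letting \<open>N\<close> vary gives infinitely many holes
  (\<open>not_very_ample_if_holes\<close>).

  It remains to find \<open>S\<close>, and this is a three-dimensional question. Given a pattern
  \<open>D\<close> in the first three coordinates, let the others range over \<open>{1, 2}\<close>. For \<open>n \<ge> 4\<close> lines in the
  fourth direction already force \<open>U\<close> to vanish off \<open>S\<close>, so that \<open>D\<close> needs only an odd closed walk;
  there is such a pattern of format \<open>3 \<times> 3 \<times> 3\<close>. For \<open>n = 3\<close> the vanishing has to come from \<open>D\<close>
  itself. A pattern of format \<open>6 \<times> 4 \<times> 3\<close>, the incidences of edges and vertices of the complete graph
  \<open>K\<^sub>4\<close>, achieves it. A pattern of format \<open>4 \<times> 4 \<times> 4\<close> leaves two cells undecided, but two odd walks
  linked by a line exclude both at once.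
\<close>

section \<open>Line sums of tables and the spans of the configuration\<close>

definition box :: "nat \<Rightarrow> (nat \<Rightarrow> nat) \<Rightarrow> (nat \<Rightarrow> nat) set" where
  "box n r = (\<Pi>\<^sub>E k\<in>{1..n}. {1..r k})"

definition line_sum :: "(nat \<Rightarrow> nat) \<Rightarrow> nat \<Rightarrow> ((nat \<Rightarrow> nat) \<Rightarrow> rat) \<Rightarrow> (nat \<Rightarrow> nat) \<Rightarrow> rat" where
  "line_sum r k T i = (\<Sum>t = 1..r k. T (i(k := t)))"

definition config_vec :: "nat \<Rightarrow> (nat \<Rightarrow> nat) \<Rightarrow> (nat \<times> (nat \<Rightarrow> nat)) \<Rightarrow>\<^sub>0 nat" where
  "config_vec n i = (\<Sum>k = 1..n. unit_vec n k i)"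

definition margins ::
  "nat \<Rightarrow> (nat \<Rightarrow> nat) \<Rightarrow> ((nat \<Rightarrow> nat) \<Rightarrow> rat) \<Rightarrow> (nat \<times> (nat \<Rightarrow> nat)) \<Rightarrow> rat" where
  "margins n r T v = (\<Sum>i\<in>box n r. T i * of_nat (Poly_Mapping.lookup (config_vec n i) v))"

lemma finite_box: "finite (box n r)"
  unfolding box_def by (intro finite_PiE) auto

lemma no_way_config_eq: "no_way_config n r = config_vec n ` box n r"
  unfolding no_way_config_def config_vec_def box_def by auto

lemma box_upd: "i \<in> box n r \<Longrightarrow> k \<in> {1..n} \<Longrightarrow> t \<in> {1..r k} \<Longrightarrow> i(k := t) \<in> box n r"
  unfolding box_def by (auto simp: PiE_iff extensional_def)

lemma line_sum_upd: "line_sum r k T (i(k := t)) = line_sum r k T i"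
  unfolding line_sum_def by simp

lemma line_sum_add: "line_sum r k (\<lambda>i. S i + T i) i = line_sum r k S i + line_sum r k T i"
  unfolding line_sum_def by (simp add: sum.distrib)

lemma line_sum_diff: "line_sum r k (\<lambda>i. S i - T i) i = line_sum r k S i - line_sum r k T i"
  unfolding line_sum_def by (simp add: sum_subtractf)

lemma lookup_config_vec:
  "Poly_Mapping.lookup (config_vec n i) (k, c) =
     (if k \<in> {1..n} \<and> restrict i ({1..n} - {k}) = c then 1 else 0)"
proof -
  have "Poly_Mapping.lookup (config_vec n i) (k, c) =
      (\<Sum>l = 1..n. if l = k then (if restrict i ({1..n} - {k}) = c then 1 else 0) else 0)"
    unfolding config_vec_def lookup_sum
    by (intro sum.cong) (auto simp: unit_vec_def lookup_single when_def)
  then show ?thesis by (simp add: sum.delta')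
qed

lemma inj_on_config_vec:
  assumes "n \<ge> 2"
  shows "inj_on (config_vec n) (box n r)"
proof (rule inj_onI)
  fix i j assume ij: "i \<in> box n r" "j \<in> box n r" and eq: "config_vec n i = config_vec n j"
  have res: "restrict i ({1..n} - {k}) = restrict j ({1..n} - {k})" if "k \<in> {1..n}" for k
  proof -
    have "Poly_Mapping.lookup (config_vec n j) (k, restrict i ({1..n} - {k})) = 1"
      using that by (simp add: eq[symmetric] lookup_config_vec)
    then show ?thesis unfolding lookup_config_vec by (metis zero_neq_one)
  qed
  have "i l = j l" if "l \<in> {1..n}" for l
  proof -
    define k :: nat where "k = (if l = 1 then 2 else 1)"
    have "k \<in> {1..n}" "k \<noteq> l"
      using assms by (auto simp: k_def)
    with that have "restrict i ({1..n} - {k}) l = i l" "restrict j ({1..n} - {k}) l = j l"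
      by simp_all
    then show ?thesis using res[OF \<open>k \<in> {1..n}\<close>] by metis
  qed
  then show "i = j" using ij unfolding box_def by (intro PiE_ext) auto
qed

text \<open>
  The vectors of two cells share their \<open>k\<close>-th summand exactly when the cells lie on a common line in
  direction \<open>k\<close>.
\<close>

lemma margins_eq_line_sum:
  assumes "i \<in> box n r" "k \<in> {1..n}"
  shows "margins n r T (k, restrict i ({1..n} - {k})) = line_sum r k T i"
proof -
  have line: "{j \<in> box n r. restrict j ({1..n} - {k}) = restrict i ({1..n} - {k})} =
      (\<lambda>t. i(k := t)) ` {1..r k}" (is "?L = ?R")
  proof
    show "?R \<subseteq> ?L" using assms box_upd by (auto intro!: restrict_ext split: if_splits)
    show "?L \<subseteq> ?R"
    proof
      fix j assume "j \<in> ?L"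
      then have j: "j \<in> box n r" and eq: "restrict j ({1..n} - {k}) = restrict i ({1..n} - {k})" by auto
      have "j = i(k := j k)"
      proof
        fix l
        show "j l = (i(k := j k)) l"
        proof (cases "l \<in> {1..n} - {k}")
          case True
          then show ?thesis using fun_cong[OF eq, of l] by simp
        next
          case False
          then show ?thesis using j assms(1) unfolding box_def by (auto simp: PiE_iff extensional_def)
        qed
      qed
      moreover have "j k \<in> {1..r k}" using j assms(2) unfolding box_def by (auto simp: PiE_iff)
      ultimately show "j \<in> ?R" by (rule image_eqI)
    qed
  qed
  have inj: "inj_on (\<lambda>t. i(k := t)) {1..r k}"
    by (rule inj_onI) (rule fun_upd_eqD)
  have "margins n r T (k, restrict i ({1..n} - {k})) =
      (\<Sum>j\<in>box n r. if restrict j ({1..n} - {k}) = restrict i ({1..n} - {k}) then T j else 0)"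
    unfolding margins_def using assms(2) by (intro sum.cong) (auto simp: lookup_config_vec)
  also have "\<dots> = (\<Sum>j\<in>?L. T j)"
    by (intro sum.inter_filter[symmetric] finite_box)
  also have "\<dots> = line_sum r k T i"
    unfolding line line_sum_def by (subst sum.reindex[OF inj]) simp
  finally show ?thesis .
qed

lemma margins_cong:
  assumes "\<And>k i. k \<in> {1..n} \<Longrightarrow> i \<in> box n r \<Longrightarrow> line_sum r k S i = line_sum r k T i"
  shows "margins n r S = margins n r T"
proof
  fix v :: "nat \<times> (nat \<Rightarrow> nat)"
  obtain k c where v: "v = (k, c)" by fastforce
  show "margins n r S v = margins n r T v"
  proof (cases "k \<in> {1..n} \<and> (\<exists>i\<in>box n r. c = restrict i ({1..n} - {k}))")
    case True
    then show ?thesis using assms margins_eq_line_sum unfolding v by auto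
  next
    case False
    then show ?thesis unfolding margins_def v
      by (intro sum.cong) (auto simp: lookup_config_vec)
  qed
qed

lemma sum_no_way_config:
  assumes "n \<ge> 2"
  shows "(\<Sum>a\<in>no_way_config n r. f a * of_nat (Poly_Mapping.lookup a v)) =
         margins n r (\<lambda>i. f (config_vec n i)) v"
  unfolding no_way_config_eq margins_def by (subst sum.reindex[OF inj_on_config_vec[OF assms]]) simp

lemma nat_span_no_way_configE:
  assumes "n \<ge> 2" "x \<in> nat_span (no_way_config n r)"
  obtains U :: "(nat \<Rightarrow> nat) \<Rightarrow> nat" where "x = margins n r (\<lambda>i. of_nat (U i))"
proof -
  obtain c :: "_ \<Rightarrow> nat" where
    "x = (\<lambda>v. \<Sum>a\<in>no_way_config n r. of_nat (c a) * of_nat (Poly_Mapping.lookup a v))"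
    using assms(2) unfolding nat_span_def by blast
  then have "x = margins n r (\<lambda>i. of_nat (c (config_vec n i)))"
    by (simp add: fun_eq_iff sum_no_way_config[OF assms(1)])
  then show ?thesis by (rule that[of "\<lambda>i. c (config_vec n i)"])
qed

lemma margins_inv_into:
  assumes "n \<ge> 2"
  shows "margins n r (\<lambda>i. T (inv_into (box n r) (config_vec n) (config_vec n i))) = margins n r T"
  unfolding margins_def using inv_into_f_f[OF inj_on_config_vec[OF assms]]
  by (intro ext sum.cong) auto

lemma margins_in_int_span:
  fixes W :: "(nat \<Rightarrow> nat) \<Rightarrow> int"
  assumes "n \<ge> 2"
  shows "margins n r (\<lambda>i. of_int (W i)) \<in> int_span (no_way_config n r)"
  by (rule int_spanI[where c = "\<lambda>a. W (inv_into (box n r) (config_vec n) a)"])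
    (simp add: fun_eq_iff sum_no_way_config[OF assms, where f = "\<lambda>a. of_int (W (inv_into (box n r) (config_vec n) a))"]
      margins_inv_into[OF assms, where T = "\<lambda>i. of_int (W i)"])

lemma margins_in_rat_cone:
  assumes "n \<ge> 2" "\<And>i. i \<in> box n r \<Longrightarrow> 0 \<le> T i"
  shows "margins n r T \<in> rat_cone (no_way_config n r)"
proof -
  let ?c = "\<lambda>a. T (inv_into (box n r) (config_vec n) a)"
  have "margins n r T = (\<lambda>v. \<Sum>a\<in>no_way_config n r. ?c a * of_nat (Poly_Mapping.lookup a v))"
    using margins_inv_into[OF assms(1), of r T] sum_no_way_config[OF assms(1), where f = ?c]
    by (simp add: fun_eq_iff)
  moreover have "\<forall>a\<in>no_way_config n r. 0 \<le> ?c a"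
    using assms(2) inv_into_f_f[OF inj_on_config_vec[OF assms(1)]] unfolding no_way_config_eq by auto
  ultimately show ?thesis unfolding rat_cone_def by (intro CollectI exI[of _ ?c]) auto
qed

lemma Ints_line_sum:
  assumes "\<And>i. i \<in> box n r \<Longrightarrow> T i \<in> \<int>" "k \<in> {1..n}" "i \<in> box n r"
  shows "line_sum r k T i \<in> \<int>"
  unfolding line_sum_def using assms box_upd by (intro Ints_sum) auto

section \<open>Integer line sums come from integer tables\<close>

text \<open>
  Let \<open>P\<^sub>k\<close> replace a table by its line sums in direction \<open>k\<close>, written into the slice \<open>i\<^sub>k = 1\<close>. Then
  \<open>1 - P\<^sub>k\<close> kills the line sums in direction \<open>k\<close> and keeps those that vanish in other directions, so
  \<open>R = (1 - P\<^sub>n) \<dots> (1 - P\<^sub>1) T\<close> has only zero line sums. As the line sums of \<open>T\<close> are integers, each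
  step alters the table by integers only; hence \<open>T - R\<close> is integral, with the line sums of \<open>T\<close>.
\<close>

lemma integral_line_sums_lift:
  fixes T :: "(nat \<Rightarrow> nat) \<Rightarrow> rat"
  assumes pos: "\<And>k. k \<in> {1..n} \<Longrightarrow> r k \<ge> 1"
    and int: "\<And>k i. k \<in> {1..n} \<Longrightarrow> i \<in> box n r \<Longrightarrow> line_sum r k T i \<in> \<int>"
  obtains W :: "(nat \<Rightarrow> nat) \<Rightarrow> int"
  where "\<And>k i. k \<in> {1..n} \<Longrightarrow> i \<in> box n r \<Longrightarrow> line_sum r k (\<lambda>i. of_int (W i)) i = line_sum r k T i"
proof -
  have "\<exists>R. (\<forall>i\<in>box n r. T i - R i \<in> \<int>) \<and> (\<forall>k\<in>{1..m}. \<forall>i\<in>box n r. line_sum r k R i = 0)"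
    if "m \<le> n" for m
    using that
  proof (induction m)
    case 0
    show ?case by (intro exI[of _ T]) auto
  next
    case (Suc m)
    from Suc.IH[OF Suc_leD[OF Suc.prems]] obtain R where R1: "\<And>i. i \<in> box n r \<Longrightarrow> T i - R i \<in> \<int>"
      and R2: "\<And>k i. k \<in> {1..m} \<Longrightarrow> i \<in> box n r \<Longrightarrow> line_sum r k R i = 0" by blast
    let ?l = "Suc m"
    have l: "?l \<in> {1..n}" using Suc.prems by simp
    define P where "P i = (if i ?l = 1 then line_sum r ?l R i else 0)" for i
    have Rint: "line_sum r ?l R i \<in> \<int>" if "i \<in> box n r" for i
    proof -
      have "line_sum r ?l R i = line_sum r ?l T i - line_sum r ?l (\<lambda>i. T i - R i) i"
        by (simp add: line_sum_diff)
      then show ?thesis using int[OF l that] Ints_line_sum[OF R1 l that] by simp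
    qed
    have "T i - (R i - P i) \<in> \<int>" if "i \<in> box n r" for i
    proof -
      have "T i - (R i - P i) = (T i - R i) + P i" by simp
      moreover have "P i \<in> \<int>" using Rint[OF that] by (simp add: P_def)
      ultimately show ?thesis using R1[OF that] by (metis Ints_add)
    qed
    moreover have "line_sum r k (\<lambda>i. R i - P i) i = 0" if k: "k \<in> {1..?l}" and i: "i \<in> box n r" for k i
    proof (cases "k = ?l")
      case True
      have "line_sum r ?l P i = (\<Sum>t = 1..r ?l. if t = 1 then line_sum r ?l R i else 0)"
        unfolding line_sum_def[of r ?l P] P_def by (intro sum.cong) (auto simp: line_sum_upd)
      also have "\<dots> = line_sum r ?l R i" using pos[OF l] by simp
      finally show ?thesis by (simp add: True line_sum_diff)
    next
      case False
      then have k': "k \<in> {1..m}" using k by auto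
      have "line_sum r k P i = (if i ?l = 1 then \<Sum>t = 1..r k. line_sum r ?l R (i(k := t)) else 0)"
        unfolding line_sum_def[of r k P] P_def using False by auto
      moreover have "(\<Sum>t = 1..r k. line_sum r ?l R (i(k := t))) = (\<Sum>s = 1..r ?l. line_sum r k R (i(?l := s)))"
        unfolding line_sum_def using False by (subst sum.swap) (simp add: fun_upd_twist)
      moreover have "(\<Sum>s = 1..r ?l. line_sum r k R (i(?l := s))) = 0"
        using R2[OF k'] box_upd[OF i l] by (intro sum.neutral) blast
      ultimately show ?thesis using R2[OF k' i] by (simp add: line_sum_diff)
    qed
    ultimately show ?case by (intro exI[of _ "\<lambda>i. R i - P i"]) auto
  qed
  from this[OF order_refl] obtain R where R1: "\<And>i. i \<in> box n r \<Longrightarrow> T i - R i \<in> \<int>"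
    and R2: "\<And>k i. k \<in> {1..n} \<Longrightarrow> i \<in> box n r \<Longrightarrow> line_sum r k R i = 0" by blast
  have floor: "of_int \<lfloor>T i - R i\<rfloor> = T i - R i" if "i \<in> box n r" for i
    using R1[OF that] by (auto elim!: Ints_cases)
  show ?thesis
  proof (rule that[of "\<lambda>i. \<lfloor>T i - R i\<rfloor>"])
    fix k i assume ki: "k \<in> {1..n}" "i \<in> box n r"
    have "line_sum r k (\<lambda>i. of_int \<lfloor>T i - R i\<rfloor>) i = line_sum r k (\<lambda>i. T i - R i) i"
      unfolding line_sum_def using floor box_upd[OF ki(2,1)] by (intro sum.cong) auto
    then show "line_sum r k (\<lambda>i. of_int \<lfloor>T i - R i\<rfloor>) i = line_sum r k T i"
      by (simp add: line_sum_diff R2[OF ki])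
  qed
qed

text \<open>
  The cell \<open>e\<close> carries the parameter \<open>N\<close> that makes the set of holes infinite: \<open>N\<close> can be read off
  from the line sum through \<open>e\<close> in direction \<open>1\<close>.
\<close>

lemma not_very_ample_if_holes:
  fixes T :: "(nat \<Rightarrow> nat) \<Rightarrow> rat"
  assumes n: "n \<ge> 2" and pos: "\<And>k. k \<in> {1..n} \<Longrightarrow> r k \<ge> 1"
    and nonneg: "\<And>i. i \<in> box n r \<Longrightarrow> 0 \<le> T i"
    and int: "\<And>k i. k \<in> {1..n} \<Longrightarrow> i \<in> box n r \<Longrightarrow> line_sum r k T i \<in> \<int>"
    and e: "e \<in> box n r"
    and hole: "\<And>(N :: nat) (U :: (nat \<Rightarrow> nat) \<Rightarrow> nat).
        (\<And>k i. k \<in> {1..n} \<Longrightarrow> i \<in> box n r \<Longrightarrow>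
           line_sum r k (\<lambda>i. of_nat (U i)) i = line_sum r k (\<lambda>i. T i + of_nat N * of_bool (i = e)) i) \<Longrightarrow> False"
  shows "\<not> very_ample (no_way_config n r)"
proof -
  let ?T = "\<lambda>N i. T i + of_nat N * of_bool (i = e)"
  let ?x = "\<lambda>N :: nat. margins n r (?T N)"
  have Tint: "line_sum r k (?T N) i \<in> \<int>" if ki: "k \<in> {1..n}" "i \<in> box n r" for k i N
  proof -
    have "line_sum r k (\<lambda>i. of_nat N * of_bool (i = e)) i \<in> \<int>"
      using ki by (intro Ints_line_sum[of n r]) auto
    then show ?thesis using int[OF ki] by (simp add: line_sum_add)
  qed
  have "?x N \<in> (int_span (no_way_config n r) \<inter> rat_cone (no_way_config n r)) - nat_span (no_way_config n r)" for N
  proof (intro DiffI IntI)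
    obtain W :: "_ \<Rightarrow> int" where
      "\<And>k i. k \<in> {1..n} \<Longrightarrow> i \<in> box n r \<Longrightarrow> line_sum r k (\<lambda>i. of_int (W i)) i = line_sum r k (?T N) i"
      using integral_line_sums_lift[OF pos Tint] by blast
    from margins_cong[OF this] show "?x N \<in> int_span (no_way_config n r)"
      using margins_in_int_span[OF n, of r W] by simp
    show "?x N \<in> rat_cone (no_way_config n r)"
      using nonneg by (intro margins_in_rat_cone n) auto
    show "?x N \<notin> nat_span (no_way_config n r)"
    proof
      assume "?x N \<in> nat_span (no_way_config n r)"
      then obtain U :: "_ \<Rightarrow> nat" where U: "?x N = margins n r (\<lambda>i. of_nat (U i))"
        using nat_span_no_way_configE[OF n] by blast
      show False
      proof (rule hole[of U N])
        fix k i assume ki: "k \<in> {1..n}" "i \<in> box n r"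
        show "line_sum r k (\<lambda>i. of_nat (U i)) i = line_sum r k (?T N) i"
          using fun_cong[OF U] by (simp only: margins_eq_line_sum[OF ki(2,1), symmetric])
      qed
    qed
  qed
  moreover have "inj ?x"
  proof (rule injI)
    fix M N :: nat
    assume eq: "?x M = ?x N"
    have one: "1 \<in> {1..n}" using n by simp
    have "line_sum r 1 (?T M) e = line_sum r 1 (?T N) e"
      unfolding margins_eq_line_sum[OF e one, symmetric] by (rule fun_cong[OF eq])
    moreover have "line_sum r 1 (?T N) e = line_sum r 1 T e + of_nat N" for N
    proof -
      have "e 1 \<in> {1..r 1}" using e n unfolding box_def by (auto simp: PiE_iff)
      have "(e(1 := t) = e) = (t = e 1)" for t by (metis fun_upd_same fun_upd_triv)
      then have "line_sum r 1 (\<lambda>i. of_nat N * of_bool (i = e)) e =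
          (\<Sum>t = 1..r 1. if t = e 1 then of_nat N else 0)"
        unfolding line_sum_def by (intro sum.cong) auto
      then show ?thesis using \<open>e 1 \<in> {1..r 1}\<close> by (simp add: line_sum_add)
    qed
    ultimately show "M = N" by simp
  qed
  ultimately show ?thesis unfolding very_ample_def
    by (meson finite_subset image_subset_iff infinite_UNIV_nat finite_image_iff)
qed

section \<open>Reduction to patterns in three dimensions\<close>

definition cell :: "nat \<Rightarrow> nat \<Rightarrow> nat \<Rightarrow> nat \<Rightarrow> nat \<Rightarrow> nat" where
  "cell n x y z = (\<lambda>k\<in>{1..n}. if k = 1 then x else if k = 2 then y else if k = 3 then z else 1)"

definition doubled :: "nat \<Rightarrow> (nat \<times> nat \<times> nat) set \<Rightarrow> (nat \<Rightarrow> nat) set" where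
  "doubled n D = {i. (i 1, i 2, i 3) \<in> D \<and> (\<forall>k\<in>{4..n}. i k \<le> 2)}"

text \<open>
  \<open>V\<close> is a natural table with the line sums of \<open>1/2\<close> on \<open>D\<close>, as far as lines that avoid the cell
  \<open>e\<close> are concerned. The lines through \<open>e\<close> are exempt because \<open>e\<close> carries an arbitrary additional
  weight.
\<close>

definition half_table ::
  "(nat \<times> nat \<times> nat) set \<Rightarrow> nat \<times> nat \<times> nat \<Rightarrow> nat \<Rightarrow> nat \<Rightarrow> nat \<Rightarrow> (nat \<Rightarrow> nat \<Rightarrow> nat \<Rightarrow> nat) \<Rightarrow> bool" where
  "half_table D e a b c V \<longleftrightarrow>
     (\<forall>y\<in>{1..b}. \<forall>z\<in>{1..c}. (\<forall>x. (x, y, z) \<noteq> e) \<longrightarrow> 2 * (\<Sum>x = 1..a. V x y z) = card {x. (x, y, z) \<in> D}) \<and>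
     (\<forall>x\<in>{1..a}. \<forall>z\<in>{1..c}. (\<forall>y. (x, y, z) \<noteq> e) \<longrightarrow> 2 * (\<Sum>y = 1..b. V x y z) = card {y. (x, y, z) \<in> D}) \<and>
     (\<forall>x\<in>{1..a}. \<forall>y\<in>{1..b}. (\<forall>z. (x, y, z) \<noteq> e) \<longrightarrow> 2 * (\<Sum>z = 1..c. V x y z) = card {z. (x, y, z) \<in> D})"

lemma cell_upd:
  assumes "n \<ge> 3"
  shows "(cell n x y z)(1 := t) = cell n t y z"
    "(cell n x y z)(2 := t) = cell n x t z"
    "(cell n x y z)(3 := t) = cell n x y t"
  using assms by (auto simp: cell_def fun_eq_iff)

lemma cell_apply:
  assumes "n \<ge> 3"
  shows "cell n x y z 1 = x" "cell n x y z 2 = y" "cell n x y z 3 = z"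
    "k \<in> {4..n} \<Longrightarrow> cell n x y z k = 1"
  using assms by (auto simp: cell_def)

lemma cell_in_box:
  assumes "n \<ge> 3" "\<And>k. k \<in> {1..n} \<Longrightarrow> r k \<ge> 1"
    and "x \<in> {1..r 1}" "y \<in> {1..r 2}" "z \<in> {1..r 3}"
  shows "cell n x y z \<in> box n r"
  using assms unfolding box_def cell_def by (auto simp: PiE_iff)

lemma line_sum_half_indicator:
  "line_sum r k (\<lambda>i. of_bool (i \<in> S) / 2) i = of_nat (card {t \<in> {1..r k}. i(k := t) \<in> S}) / 2"
proof -
  have "(\<Sum>t = 1..r k. of_bool (i(k := t) \<in> S) :: rat) = of_nat (card {t \<in> {1..r k}. i(k := t) \<in> S})"
    by (simp add: of_bool_def sum.If_cases Int_def)
  then show ?thesis unfolding line_sum_def by (simp add: sum_divide_distrib[symmetric])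
qed

lemma even_card_doubled_line:
  assumes n: "n \<ge> 3" and r2: "\<And>k. k \<in> {1..n} \<Longrightarrow> r k \<ge> 2"
    and D: "D \<subseteq> {1..r 1} \<times> {1..r 2} \<times> {1..r 3}"
    and even1: "\<And>y z. even (card {x. (x, y, z) \<in> D})"
    and even2: "\<And>x z. even (card {y. (x, y, z) \<in> D})"
    and even3: "\<And>x y. even (card {z. (x, y, z) \<in> D})"
    and k: "k \<in> {1..n}"
  shows "even (card {t \<in> {1..r k}. i(k := t) \<in> doubled n D})"
proof -
  consider "k = 1" | "k = 2" | "k = 3" | "k \<ge> 4" using k by force
  then show ?thesis
  proof cases
    case 1
    have "{t \<in> {1..r k}. i(k := t) \<in> doubled n D} =
        (if \<forall>l\<in>{4..n}. i l \<le> 2 then {x. (x, i 2, i 3) \<in> D} else {})"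
      using D by (auto simp: doubled_def 1)
    then show ?thesis using even1 by simp
  next
    case 2
    have "{t \<in> {1..r k}. i(k := t) \<in> doubled n D} =
        (if \<forall>l\<in>{4..n}. i l \<le> 2 then {y. (i 1, y, i 3) \<in> D} else {})"
      using D by (auto simp: doubled_def 2)
    then show ?thesis using even2 by simp
  next
    case 3
    have "{t \<in> {1..r k}. i(k := t) \<in> doubled n D} =
        (if \<forall>l\<in>{4..n}. i l \<le> 2 then {z. (i 1, i 2, z) \<in> D} else {})"
      using D by (auto simp: doubled_def 3)
    then show ?thesis using even3 by simp
  next
    case 4
    have "{t \<in> {1..r k}. i(k := t) \<in> doubled n D} =
        (if (i 1, i 2, i 3) \<in> D \<and> (\<forall>l\<in>{4..n} - {k}. i l \<le> 2) then {1, 2} else {})"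
      using k r2[OF k] 4 by (auto simp: doubled_def)
    then show ?thesis by simp
  qed
qed

text \<open>
  If a natural table \<open>U\<close> has the line sums of a supposed hole, its slice with all coordinates after the
  third equal to \<open>1\<close> is a half table for \<open>D\<close>. The slice is \<open>0\<close> off \<open>D\<close> when there is a fourth direction, since a line in
  that direction over a cell outside \<open>D\<close> misses the support altogether.
\<close>

lemma not_very_ample_if_no_half_table:
  assumes n: "n \<ge> 3" and r2: "\<And>k. k \<in> {1..n} \<Longrightarrow> r k \<ge> 2"
    and D: "D \<subseteq> {1..r 1} \<times> {1..r 2} \<times> {1..r 3}"
    and even1: "\<And>y z. even (card {x. (x, y, z) \<in> D})"
    and even2: "\<And>x z. even (card {y. (x, y, z) \<in> D})"
    and even3: "\<And>x y. even (card {z. (x, y, z) \<in> D})"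
    and e: "(p, q, s) \<in> D"
    and no_half_table: "\<And>V. half_table D (p, q, s) (r 1) (r 2) (r 3) V \<Longrightarrow>
      (\<And>x y z. n \<ge> 4 \<Longrightarrow> x \<in> {1..r 1} \<Longrightarrow> y \<in> {1..r 2} \<Longrightarrow> z \<in> {1..r 3} \<Longrightarrow> (x, y, z) \<notin> D \<Longrightarrow> V x y z = 0) \<Longrightarrow>
      False"
  shows "\<not> very_ample (no_way_config n r)"
proof -
  define S where "S = doubled n D"
  \<comment> \<open>With a fourth coordinate available, the additional weight is moved out of the slice.\<close>
  define e' where "e' = (if n \<ge> 4 then (cell n p q s)(4 := 2) else cell n p q s)"
  have r1: "r k \<ge> 1" if "k \<in> {1..n}" for k using r2[OF that] by simp
  have pqs: "p \<in> {1..r 1}" "q \<in> {1..r 2}" "s \<in> {1..r 3}" using D e by auto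
  have e'_box: "e' \<in> box n r"
    using cell_in_box[OF n r1 pqs] r2[of 4] by (auto simp: e'_def intro: box_upd)
  have e'_apply: "e' 1 = p" "e' 2 = q" "e' 3 = s" "n \<ge> 4 \<Longrightarrow> e' 4 = 2"
    using cell_apply[OF n] by (auto simp: e'_def)
  show ?thesis
  proof (rule not_very_ample_if_holes[where T = "\<lambda>i. of_bool (i \<in> S) / 2" and e = e'])
    show "n \<ge> 2" using n by simp
    show "e' \<in> box n r" by (rule e'_box)
    show "line_sum r k (\<lambda>i. of_bool (i \<in> S) / 2) i \<in> \<int>" if k: "k \<in> {1..n}" for k i
    proof -
      obtain m where "card {t \<in> {1..r k}. i(k := t) \<in> S} = 2 * m"
        using even_card_doubled_line[OF n r2 D even1 even2 even3 k] unfolding S_def by blast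
      then show ?thesis by (simp add: line_sum_half_indicator)
    qed
  next
    fix N :: nat and U :: "(nat \<Rightarrow> nat) \<Rightarrow> nat"
    assume U: "line_sum r k (\<lambda>i. of_nat (U i)) i =
        line_sum r k (\<lambda>i. of_bool (i \<in> S) / 2 + of_nat N * of_bool (i = e')) i"
      if "k \<in> {1..n}" "i \<in> box n r" for k i
    have line: "2 * (\<Sum>t = 1..r k. U (i(k := t))) = card {t \<in> {1..r k}. i(k := t) \<in> S}"
      if ki: "k \<in> {1..n}" "i \<in> box n r" and e': "\<And>t. i(k := t) \<noteq> e'" for k i
    proof -
      have "line_sum r k (\<lambda>i. of_nat N * of_bool (i = e')) i = 0"
        unfolding line_sum_def using e' by simp
      then have "of_nat (2 * (\<Sum>t = 1..r k. U (i(k := t)))) =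
          (of_nat (card {t \<in> {1..r k}. i(k := t) \<in> S}) :: rat)"
        using U[OF ki] by (simp add: line_sum_add line_sum_half_indicator) (simp add: line_sum_def)
      then show ?thesis by (simp only: of_nat_eq_iff)
    qed
    have cell_S: "cell n x y z \<in> S \<longleftrightarrow> (x, y, z) \<in> D" for x y z
      using cell_apply[OF n] by (auto simp: S_def doubled_def)
    have ax: "1 \<in> {1..n}" "2 \<in> {1..n}" "3 \<in> {1..n}" using n by auto
    have one: "1 \<in> {1..r 1}" "1 \<in> {1..r 2}" "1 \<in> {1..r 3}" using r1 ax by auto
    have cell_e': "cell n x y z = e' \<Longrightarrow> (x, y, z) = (p, q, s)" for x y z
      using e'_apply cell_apply[OF n] by auto
    show False
    proof (rule no_half_table[of "\<lambda>x y z. U (cell n x y z)"])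
      show "half_table D (p, q, s) (r 1) (r 2) (r 3) (\<lambda>x y z. U (cell n x y z))"
        unfolding half_table_def
      proof (intro conjI ballI impI)
        fix y z assume *: "y \<in> {1..r 2}" "z \<in> {1..r 3}" "\<forall>x. (x, y, z) \<noteq> (p, q, s)"
        have "2 * (\<Sum>x = 1..r 1. U (cell n x y z)) = card {x \<in> {1..r 1}. (x, y, z) \<in> D}"
          using line[OF ax(1) cell_in_box[OF n r1 one(1) *(1,2)]] *(3) cell_e'
          unfolding cell_upd[OF n] cell_S by blast
        also have "{x \<in> {1..r 1}. (x, y, z) \<in> D} = {x. (x, y, z) \<in> D}" using D by auto
        finally show "2 * (\<Sum>x = 1..r 1. U (cell n x y z)) = card {x. (x, y, z) \<in> D}" .
      next
        fix x z assume *: "x \<in> {1..r 1}" "z \<in> {1..r 3}" "\<forall>y. (x, y, z) \<noteq> (p, q, s)"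
        have "2 * (\<Sum>y = 1..r 2. U (cell n x y z)) = card {y \<in> {1..r 2}. (x, y, z) \<in> D}"
          using line[OF ax(2) cell_in_box[OF n r1 *(1) one(2) *(2)]] *(3) cell_e'
          unfolding cell_upd[OF n] cell_S by blast
        also have "{y \<in> {1..r 2}. (x, y, z) \<in> D} = {y. (x, y, z) \<in> D}" using D by auto
        finally show "2 * (\<Sum>y = 1..r 2. U (cell n x y z)) = card {y. (x, y, z) \<in> D}" .
      next
        fix x y assume *: "x \<in> {1..r 1}" "y \<in> {1..r 2}" "\<forall>z. (x, y, z) \<noteq> (p, q, s)"
        have "2 * (\<Sum>z = 1..r 3. U (cell n x y z)) = card {z \<in> {1..r 3}. (x, y, z) \<in> D}"
          using line[OF ax(3) cell_in_box[OF n r1 *(1,2) one(3)]] *(3) cell_e'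
          unfolding cell_upd[OF n] cell_S by blast
        also have "{z \<in> {1..r 3}. (x, y, z) \<in> D} = {z. (x, y, z) \<in> D}" using D by auto
        finally show "2 * (\<Sum>z = 1..r 3. U (cell n x y z)) = card {z. (x, y, z) \<in> D}" .
      qed
    next
      fix x y z assume n4: "n \<ge> 4" and xyz: "x \<in> {1..r 1}" "y \<in> {1..r 2}" "z \<in> {1..r 3}" "(x, y, z) \<notin> D"
      let ?i = "cell n x y z"
      have four: "4 \<in> {1..n}" using n4 by simp
      have upd: "(?i(4 := t)) 1 = x" "(?i(4 := t)) 2 = y" "(?i(4 := t)) 3 = z" for t
        using cell_apply[OF n] by simp_all
      have "?i(4 := t) \<noteq> e'" "?i(4 := t) \<notin> S" for t
        using upd[of t] xyz(4) e e'_apply by (auto simp: S_def doubled_def)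
      then have "(\<Sum>t = 1..r 4. U (?i(4 := t))) = 0"
        using line[OF four cell_in_box[OF n r1 xyz(1-3)]] by simp
      then have "U (?i(4 := 1)) = 0" using r1[OF four] by simp
      moreover have "?i(4 := 1) = ?i" using cell_apply(4)[OF n, of 4] n4 by (simp add: fun_upd_idem)
      ultimately show "U ?i = 0" by simp
    qed
  qed (use r1 in auto)
qed

section \<open>Using the line sums of a half table\<close>

text \<open>
  The cells that are not forced to be \<open>0\<close> in a nonnegative table by its having the zero line sums of
  a table supported on \<open>D\<close>.
\<close>

definition line_closure :: "(nat \<times> nat \<times> nat) set \<Rightarrow> (nat \<times> nat \<times> nat) set" where
  "line_closure D = {(x, y, z). (\<exists>x'. (x', y, z) \<in> D) \<and> (\<exists>y'. (x, y', z) \<in> D) \<and> (\<exists>z'. (x, y, z') \<in> D)}"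

lemma half_table_zero_off_closure:
  assumes V: "half_table D e a b c V" and e: "e \<in> D"
    and xyz: "x \<in> {1..a}" "y \<in> {1..b}" "z \<in> {1..c}" "(x, y, z) \<notin> line_closure D"
  shows "V x y z = 0"
proof -
  have zero: "f t = 0" if "2 * (\<Sum>u = 1..m. f u) = card {u. P u}" "\<forall>u. \<not> P u" "t \<in> {1..m}"
    for f :: "nat \<Rightarrow> nat" and P t m
    using that by simp
  consider "\<forall>x'. (x', y, z) \<notin> D" | "\<forall>y'. (x, y', z) \<notin> D" | "\<forall>z'. (x, y, z') \<notin> D"
    using xyz(4) unfolding line_closure_def by blast
  then show ?thesis
  proof cases
    case 1
    then have "\<forall>x'. (x', y, z) \<noteq> e" using e by auto
    then have "2 * (\<Sum>u = 1..a. V u y z) = card {u. (u, y, z) \<in> D}"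
      using V xyz unfolding half_table_def by simp
    from zero[OF this 1 xyz(1)] show ?thesis .
  next
    case 2
    then have "\<forall>y'. (x, y', z) \<noteq> e" using e by auto
    then have "2 * (\<Sum>u = 1..b. V x u z) = card {u. (x, u, z) \<in> D}"
      using V xyz unfolding half_table_def by simp
    from zero[OF this 2 xyz(2)] show ?thesis .
  next
    case 3
    then have "\<forall>z'. (x, y, z') \<noteq> e" using e by auto
    then have "2 * (\<Sum>u = 1..c. V x y u) = card {u. (x, y, u) \<in> D}"
      using V xyz unfolding half_table_def by simp
    from zero[OF this 3 xyz(3)] show ?thesis .
  qed
qed

text \<open>
  On a concrete pattern, the line sums become equations in a few cells once the other cells are known
  to vanish. The set \<open>C\<close> of remaining cells may be larger than \<open>D\<close>.
\<close>

lemma half_table_line_sums: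
  assumes V: "half_table D e a b c V" and C: "C \<subseteq> {1..a} \<times> {1..b} \<times> {1..c}"
    and zero: "\<And>x y z. x \<in> {1..a} \<Longrightarrow> y \<in> {1..b} \<Longrightarrow> z \<in> {1..c} \<Longrightarrow> (x, y, z) \<notin> C \<Longrightarrow> V x y z = 0"
  shows "y \<in> {1..b} \<Longrightarrow> z \<in> {1..c} \<Longrightarrow> \<forall>x. (x, y, z) \<noteq> e \<Longrightarrow>
      2 * (\<Sum>x | (x, y, z) \<in> C. V x y z) = card {x. (x, y, z) \<in> D}"
    and "x \<in> {1..a} \<Longrightarrow> z \<in> {1..c} \<Longrightarrow> \<forall>y. (x, y, z) \<noteq> e \<Longrightarrow>
      2 * (\<Sum>y | (x, y, z) \<in> C. V x y z) = card {y. (x, y, z) \<in> D}"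
    and "x \<in> {1..a} \<Longrightarrow> y \<in> {1..b} \<Longrightarrow> \<forall>z. (x, y, z) \<noteq> e \<Longrightarrow>
      2 * (\<Sum>z | (x, y, z) \<in> C. V x y z) = card {z. (x, y, z) \<in> D}"
proof -
  show "2 * (\<Sum>x | (x, y, z) \<in> C. V x y z) = card {x. (x, y, z) \<in> D}"
    if "y \<in> {1..b}" "z \<in> {1..c}" "\<forall>x. (x, y, z) \<noteq> e"
  proof -
    have "(\<Sum>x | (x, y, z) \<in> C. V x y z) = (\<Sum>x = 1..a. V x y z)"
      using that zero C by (intro sum.mono_neutral_left) auto
    then show ?thesis using V that unfolding half_table_def by simp
  qed
  show "2 * (\<Sum>y | (x, y, z) \<in> C. V x y z) = card {y. (x, y, z) \<in> D}"
    if "x \<in> {1..a}" "z \<in> {1..c}" "\<forall>y. (x, y, z) \<noteq> e"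
  proof -
    have "(\<Sum>y | (x, y, z) \<in> C. V x y z) = (\<Sum>y = 1..b. V x y z)"
      using that zero C by (intro sum.mono_neutral_left) auto
    then show ?thesis using V that unfolding half_table_def by simp
  qed
  show "2 * (\<Sum>z | (x, y, z) \<in> C. V x y z) = card {z. (x, y, z) \<in> D}"
    if "x \<in> {1..a}" "y \<in> {1..b}" "\<forall>z. (x, y, z) \<noteq> e"
  proof -
    have "(\<Sum>z | (x, y, z) \<in> C. V x y z) = (\<Sum>z = 1..c. V x y z)"
      using that zero C by (intro sum.mono_neutral_left) auto
    then show ?thesis using V that unfolding half_table_def by simp
  qed
qed

section \<open>A pattern of format three by three by three\<close>

text \<open>
  The pattern describes a bipartite graph between the rows \<open>x\<close> and the columns \<open>y\<close>, each of whose edges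
  lies in two of the three layers \<open>z\<close>. The graph is \<open>K\<^sub>4\<close> on the rows and columns \<open>2, 3\<close>, with
  the edge between the two rows subdivided by column \<open>1\<close> and that between the two columns by row \<open>1\<close>.
  Each of the three perfect matchings of \<open>K\<^sub>4\<close> avoids one layer. So a vertex of \<open>K\<^sub>4\<close> meets two edges
  in every layer, a subdividing vertex meets two edges in each of two layers, and all
  lines contain no or two cells.
\<close>

definition pattern_333 :: "(nat \<times> nat \<times> nat) set" where
  "pattern_333 =
     {1} \<times> {2, 3} \<times> {1, 2} \<union> {2, 3} \<times> {1} \<times> {1, 2} \<union>
     {2} \<times> {3} \<times> {1, 3} \<union> {3} \<times> {2} \<times> {1, 3} \<union>
     {2} \<times> {2} \<times> {2, 3} \<union> {3} \<times> {3} \<times> {2, 3}"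

lemma in_pattern_333:
  "(x, y, z) \<in> pattern_333 \<longleftrightarrow>
     x = 1 \<and> y \<in> {2, 3} \<and> z \<in> {1, 2} \<or> x \<in> {2, 3} \<and> y = 1 \<and> z \<in> {1, 2} \<or>
     x = 2 \<and> y = 3 \<and> z \<in> {1, 3} \<or> x = 3 \<and> y = 2 \<and> z \<in> {1, 3} \<or>
     x = 2 \<and> y = 2 \<and> z \<in> {2, 3} \<or> x = 3 \<and> y = 3 \<and> z \<in> {2, 3}"
  by (simp only: pattern_333_def Un_iff mem_Sigma_iff singleton_iff disj_assoc)

lemma even_pattern_333:
  "even (card {x. (x, y, z) \<in> pattern_333})"
  "even (card {y. (x, y, z) \<in> pattern_333})"
  "even (card {z. (x, y, z) \<in> pattern_333})"
proof -
  have "y \<in> {1, 2, 3} \<and> z \<in> {1, 2, 3} \<or> {x. (x, y, z) \<in> pattern_333} = {}"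
    by (auto simp: in_pattern_333)
  then show "even (card {x. (x, y, z) \<in> pattern_333})"
    by (elim disjE conjE insertE emptyE) (simp_all add: in_pattern_333 Collect_disj_eq Collect_conj_eq)
  have "x \<in> {1, 2, 3} \<and> z \<in> {1, 2, 3} \<or> {y. (x, y, z) \<in> pattern_333} = {}"
    by (auto simp: in_pattern_333)
  then show "even (card {y. (x, y, z) \<in> pattern_333})"
    by (elim disjE conjE insertE emptyE) (simp_all add: in_pattern_333 Collect_disj_eq Collect_conj_eq)
  have "x \<in> {1, 2, 3} \<and> y \<in> {1, 2, 3} \<or> {z. (x, y, z) \<in> pattern_333} = {}"
    by (auto simp: in_pattern_333)
  then show "even (card {z. (x, y, z) \<in> pattern_333})"
    by (elim disjE conjE insertE emptyE) (simp_all add: in_pattern_333 Collect_disj_eq Collect_conj_eq)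
qed

text \<open>
  The triangle of \<open>K\<^sub>4\<close> on the rows \<open>2, 3\<close> and column \<open>2\<close> lifts to a closed walk through seven cells:
  its four edges after subdivision each contribute a cell, and so does each change of layer along an edge, which
  happens on three of them.
\<close>

lemma no_half_table_333:
  assumes abc: "a \<ge> 3" "b \<ge> 3" "c \<ge> 3"
    and V: "half_table pattern_333 (1, 2, 1) a b c V"
    and zero: "\<And>x y z. x \<in> {1..a} \<Longrightarrow> y \<in> {1..b} \<Longrightarrow> z \<in> {1..c} \<Longrightarrow> (x, y, z) \<notin> pattern_333 \<Longrightarrow> V x y z = 0"
  shows False
proof -
  have "pattern_333 \<subseteq> {1..a} \<times> {1..b} \<times> {1..c}"
    using abc by (auto simp: pattern_333_def)
  note sums = half_table_line_sums[OF V this zero]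
  have "V 2 1 1 + V 3 1 1 = 1"
    using sums(1)[of 1 1] abc by (simp add: in_pattern_333 Collect_disj_eq)
  moreover have "V 3 1 1 + V 3 2 1 = 1"
    using sums(2)[of 3 1] abc by (simp add: in_pattern_333 Collect_disj_eq)
  moreover have "V 3 2 1 + V 3 2 3 = 1"
    using sums(3)[of 3 2] abc by (simp add: in_pattern_333 Collect_disj_eq)
  moreover have "V 2 2 3 + V 3 2 3 = 1"
    using sums(1)[of 2 3] abc by (simp add: in_pattern_333 Collect_disj_eq)
  moreover have "V 2 2 2 + V 2 2 3 = 1"
    using sums(3)[of 2 2] abc by (simp add: in_pattern_333 Collect_disj_eq)
  moreover have "V 2 1 2 + V 2 2 2 = 1"
    using sums(2)[of 2 2] abc by (simp add: in_pattern_333 Collect_disj_eq)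
  moreover have "V 2 1 1 + V 2 1 2 = 1"
    using sums(3)[of 2 1] abc by (simp add: in_pattern_333 Collect_disj_eq)
  ultimately show False by presburger
qed

section \<open>A pattern of format six by four by three\<close>

text \<open>
  The rows \<open>x\<close> are the edges of \<open>K\<^sub>4\<close>, opposite edges being \<open>{1, 2}\<close>, \<open>{3, 4}\<close> and \<open>{5, 6}\<close>, and the
  columns \<open>y\<close> are its vertices. An incidence of an edge with a vertex occupies the two layers \<open>z\<close>
  that differ from the colour of the edge, where opposite edges share a colour. This
  subdivides all edges of \<open>K\<^sub>4\<close>. A row is thus empty in the layer of its own colour,
  and this is why the pattern equals its line closure.
\<close>

definition pattern_643 :: "(nat \<times> nat \<times> nat) set" where
  "pattern_643 =
     {1} \<times> {1, 2} \<times> {2, 3} \<union> {2} \<times> {3, 4} \<times> {2, 3} \<union>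
     {3} \<times> {1, 3} \<times> {1, 3} \<union> {4} \<times> {2, 4} \<times> {1, 3} \<union>
     {5} \<times> {1, 4} \<times> {1, 2} \<union> {6} \<times> {2, 3} \<times> {1, 2}"

lemma in_pattern_643:
  "(x, y, z) \<in> pattern_643 \<longleftrightarrow>
     x = 1 \<and> y \<in> {1, 2} \<and> z \<in> {2, 3} \<or> x = 2 \<and> y \<in> {3, 4} \<and> z \<in> {2, 3} \<or>
     x = 3 \<and> y \<in> {1, 3} \<and> z \<in> {1, 3} \<or> x = 4 \<and> y \<in> {2, 4} \<and> z \<in> {1, 3} \<or>
     x = 5 \<and> y \<in> {1, 4} \<and> z \<in> {1, 2} \<or> x = 6 \<and> y \<in> {2, 3} \<and> z \<in> {1, 2}"
  by (simp only: pattern_643_def Un_iff mem_Sigma_iff singleton_iff disj_assoc)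

lemma even_pattern_643:
  "even (card {x. (x, y, z) \<in> pattern_643})"
  "even (card {y. (x, y, z) \<in> pattern_643})"
  "even (card {z. (x, y, z) \<in> pattern_643})"
proof -
  have "y \<in> {1, 2, 3, 4} \<and> z \<in> {1, 2, 3} \<or> {x. (x, y, z) \<in> pattern_643} = {}"
    by (auto simp: in_pattern_643)
  then show "even (card {x. (x, y, z) \<in> pattern_643})"
    by (elim disjE conjE insertE emptyE) (simp_all add: in_pattern_643 Collect_disj_eq Collect_conj_eq)
  have x: "x \<in> {1, 2, 3, 4, 5, 6} \<or> (\<forall>y z. (x, y, z) \<notin> pattern_643)"
    by (auto simp: in_pattern_643)
  then show "even (card {y. (x, y, z) \<in> pattern_643})"
    by (elim disjE insertE emptyE) (simp_all add: in_pattern_643 Collect_disj_eq Collect_conj_eq)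
  from x show "even (card {z. (x, y, z) \<in> pattern_643})"
    by (elim disjE insertE emptyE) (simp_all add: in_pattern_643 Collect_disj_eq Collect_conj_eq)
qed

lemma line_closure_pattern_643:
  assumes "(x, y, z) \<in> line_closure pattern_643"
  shows "(x, y, z) \<in> pattern_643"
proof -
  obtain y' z' where "(x, y', z) \<in> pattern_643" "(x, y, z') \<in> pattern_643"
    using assms unfolding line_closure_def by blast
  moreover from this have "x \<in> {1, 2, 3, 4, 5, 6}"
    by (auto simp: in_pattern_643)
  ultimately show ?thesis
    by (elim insertE emptyE) (simp_all add: in_pattern_643)
qed

text \<open>
  The walk goes around the triangle of \<open>K\<^sub>4\<close> with the edges \<open>1\<close>, \<open>6\<close> and \<open>3\<close>, and so never meets vertex
  \<open>4\<close> or edge \<open>2\<close>, where the additional weight is placed. Each edge takes two cells for its ends and a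
  third one for the change to the layer that it shares with the next edge, which makes nine cells.
\<close>

lemma no_half_table_643:
  assumes abc: "a \<ge> 6" "b \<ge> 4" "c \<ge> 3"
    and V: "half_table pattern_643 (2, 4, 2) a b c V"
  shows False
proof -
  have "(2, 4, 2) \<in> pattern_643" by (simp add: in_pattern_643)
  from half_table_zero_off_closure[OF V this] line_closure_pattern_643
  have zero: "V x y z = 0" if "x \<in> {1..a}" "y \<in> {1..b}" "z \<in> {1..c}" "(x, y, z) \<notin> pattern_643" for x y z
    using that by blast
  have "pattern_643 \<subseteq> {1..a} \<times> {1..b} \<times> {1..c}"
    using abc by (auto simp: pattern_643_def)
  note sums = half_table_line_sums[OF V this zero]
  have "V 1 1 3 + V 1 2 3 = 1"
    using sums(2)[of 1 3] abc by (simp add: in_pattern_643 Collect_disj_eq)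
  moreover have "V 1 2 2 + V 1 2 3 = 1"
    using sums(3)[of 1 2] abc by (simp add: in_pattern_643 Collect_disj_eq)
  moreover have "V 1 2 2 + V 6 2 2 = 1"
    using sums(1)[of 2 2] abc by (simp add: in_pattern_643 Collect_disj_eq)
  moreover have "V 6 2 2 + V 6 3 2 = 1"
    using sums(2)[of 6 2] abc by (simp add: in_pattern_643 Collect_disj_eq)
  moreover have "V 6 3 1 + V 6 3 2 = 1"
    using sums(3)[of 6 3] abc by (simp add: in_pattern_643 Collect_disj_eq)
  moreover have "V 3 3 1 + V 6 3 1 = 1"
    using sums(1)[of 3 1] abc by (simp add: in_pattern_643 Collect_disj_eq)
  moreover have "V 3 1 1 + V 3 3 1 = 1"
    using sums(2)[of 3 1] abc by (simp add: in_pattern_643 Collect_disj_eq)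
  moreover have "V 3 1 1 + V 3 1 3 = 1"
    using sums(3)[of 3 1] abc by (simp add: in_pattern_643 Collect_disj_eq)
  moreover have "V 1 1 3 + V 3 1 3 = 1"
    using sums(1)[of 1 3] abc by (simp add: in_pattern_643 Collect_disj_eq)
  ultimately show False by presburger
qed

section \<open>A pattern of format four by four by four\<close>

text \<open>
  These are the cells with \<open>x \<noteq> y\<close>, \<open>x \<noteq> z\<close> and \<open>z \<noteq> \<sigma> y\<close> for the transposition \<open>\<sigma> = (3 4)\<close>, except for
  \<open>(3, 4, 4)\<close> and \<open>(4, 3, 3)\<close>. With these two cells removed, every line contains no or two cells. With
  the identity in place of \<open>\<sigma>\<close> the pattern would consist of the triples of distinct numbers,
  and the parity of the permutation of \<open>{1..4}\<close> that completes a triple would alternate along walks, so that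
  all closed walks would be even.
\<close>

definition pattern_444 :: "(nat \<times> nat \<times> nat) set" where
  "pattern_444 =
     {1} \<times> {2} \<times> {3, 4} \<union> {1} \<times> {3} \<times> {2, 3} \<union> {1} \<times> {4} \<times> {2, 4} \<union>
     {2} \<times> {1} \<times> {3, 4} \<union> {2} \<times> {3} \<times> {1, 3} \<union> {2} \<times> {4} \<times> {1, 4} \<union>
     {3} \<times> {1} \<times> {2, 4} \<union> {3} \<times> {2} \<times> {1, 4} \<union> {3} \<times> {4} \<times> {1, 2} \<union>
     {4} \<times> {1} \<times> {2, 3} \<union> {4} \<times> {2} \<times> {1, 3} \<union> {4} \<times> {3} \<times> {1, 2}"

lemma in_pattern_444:
  "(x, y, z) \<in> pattern_444 \<longleftrightarrow>
     x = 1 \<and> y = 2 \<and> z \<in> {3, 4} \<or> x = 1 \<and> y = 3 \<and> z \<in> {2, 3} \<or> x = 1 \<and> y = 4 \<and> z \<in> {2, 4} \<or>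
     x = 2 \<and> y = 1 \<and> z \<in> {3, 4} \<or> x = 2 \<and> y = 3 \<and> z \<in> {1, 3} \<or> x = 2 \<and> y = 4 \<and> z \<in> {1, 4} \<or>
     x = 3 \<and> y = 1 \<and> z \<in> {2, 4} \<or> x = 3 \<and> y = 2 \<and> z \<in> {1, 4} \<or> x = 3 \<and> y = 4 \<and> z \<in> {1, 2} \<or>
     x = 4 \<and> y = 1 \<and> z \<in> {2, 3} \<or> x = 4 \<and> y = 2 \<and> z \<in> {1, 3} \<or> x = 4 \<and> y = 3 \<and> z \<in> {1, 2}"
  by (simp only: pattern_444_def Un_iff mem_Sigma_iff singleton_iff disj_assoc)

lemma even_pattern_444:
  "even (card {x. (x, y, z) \<in> pattern_444})"
  "even (card {y. (x, y, z) \<in> pattern_444})"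
  "even (card {z. (x, y, z) \<in> pattern_444})"
proof -
  have "y \<in> {1, 2, 3, 4} \<and> z \<in> {1, 2, 3, 4} \<or> {x. (x, y, z) \<in> pattern_444} = {}"
    by (auto simp: in_pattern_444)
  then show "even (card {x. (x, y, z) \<in> pattern_444})"
    by (elim disjE conjE insertE emptyE) (simp_all add: in_pattern_444 Collect_disj_eq Collect_conj_eq)
  have "x \<in> {1, 2, 3, 4} \<and> z \<in> {1, 2, 3, 4} \<or> {y. (x, y, z) \<in> pattern_444} = {}"
    by (auto simp: in_pattern_444)
  then show "even (card {y. (x, y, z) \<in> pattern_444})"
    by (elim disjE conjE insertE emptyE) (simp_all add: in_pattern_444 Collect_disj_eq Collect_conj_eq)
  have "x \<in> {1, 2, 3, 4} \<and> y \<in> {1, 2, 3, 4} \<or> {z. (x, y, z) \<in> pattern_444} = {}"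
    by (auto simp: in_pattern_444)
  then show "even (card {z. (x, y, z) \<in> pattern_444})"
    by (elim disjE conjE insertE emptyE) (simp_all add: in_pattern_444 Collect_disj_eq Collect_conj_eq)
qed

lemma line_closure_pattern_444:
  assumes "(x, y, z) \<in> line_closure pattern_444"
  shows "(x, y, z) \<in> pattern_444 \<union> {(3, 4, 4), (4, 3, 3)}"
proof -
  have ex: "\<exists>x'. (x', y, z) \<in> pattern_444" "\<exists>y'. (x, y', z) \<in> pattern_444" "\<exists>z'. (x, y, z') \<in> pattern_444"
    using assms unfolding line_closure_def by auto
  then have "x \<in> {1, 2, 3, 4}" "y \<in> {1, 2, 3, 4}" "z \<in> {1, 2, 3, 4}"
    by (auto simp: in_pattern_444)
  with ex show ?thesis
    by (elim insertE emptyE) (simp_all add: in_pattern_444)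
qed

text \<open>
  There is a closed walk of length seven all of whose lines but one contain just two cells of the line closure;
  the exceptional line contains \<open>(4, 3, 3)\<close> in addition. Instead of a contradiction the
  walk therefore gives \<open>2 * V 1 2 3 = 1 + V 4 3 3\<close>. Exchanging \<open>3\<close> and \<open>4\<close> is a symmetry of the pattern and
  gives \<open>2 * V 1 2 4 = 1 + V 3 4 4\<close>. As \<open>V 1 2 3 + V 1 2 4 = 1\<close>, both excess terms vanish, and
  \<open>2 * V 1 2 3 = 1\<close> remains.
\<close>

lemma no_half_table_444:
  assumes abc: "a \<ge> 4" "b \<ge> 4" "c \<ge> 4"
    and V: "half_table pattern_444 (2, 1, 3) a b c V"
  shows False
proof -
  have "(2, 1, 3) \<in> pattern_444" by (simp add: in_pattern_444)
  from half_table_zero_off_closure[OF V this] line_closure_pattern_444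
  have zero: "V x y z = 0" if "x \<in> {1..a}" "y \<in> {1..b}" "z \<in> {1..c}" "(x, y, z) \<notin> pattern_444 \<union> {(3, 4, 4), (4, 3, 3)}" for x y z
    using that by blast
  have "pattern_444 \<union> {(3, 4, 4), (4, 3, 3)} \<subseteq> {1..a} \<times> {1..b} \<times> {1..c}"
    using abc by (auto simp: pattern_444_def)
  note sums = half_table_line_sums[OF V this zero]
  have "2 * V 1 2 3 = 1 + V 4 3 3"
  proof -
    have "V 1 2 3 + V 1 3 3 = 1"
      using sums(2)[of 1 3] abc by (simp add: in_pattern_444 Collect_disj_eq)
    moreover have "V 1 3 2 + V 1 3 3 = 1"
      using sums(3)[of 1 3] abc by (simp add: in_pattern_444 Collect_disj_eq)
    moreover have "V 1 3 2 + V 4 3 2 = 1"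
      using sums(1)[of 3 2] abc by (simp add: in_pattern_444 Collect_disj_eq)
    moreover have "V 4 1 2 + V 4 3 2 = 1"
      using sums(2)[of 4 2] abc by (simp add: in_pattern_444 Collect_disj_eq)
    moreover have "V 4 1 2 + V 4 1 3 = 1"
      using sums(3)[of 4 1] abc by (simp add: in_pattern_444 Collect_disj_eq)
    moreover have "V 4 1 3 + V 4 2 3 + V 4 3 3 = 1"
      using sums(2)[of 4 3] abc by (simp add: in_pattern_444 Collect_disj_eq)
    moreover have "V 1 2 3 + V 4 2 3 = 1"
      using sums(1)[of 2 3] abc by (simp add: in_pattern_444 Collect_disj_eq)
    ultimately show ?thesis by linarith
  qed
  moreover have "2 * V 1 2 4 = 1 + V 3 4 4"
  proof -
    have "V 1 2 4 + V 1 4 4 = 1"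
      using sums(2)[of 1 4] abc by (simp add: in_pattern_444 Collect_disj_eq)
    moreover have "V 1 4 2 + V 1 4 4 = 1"
      using sums(3)[of 1 4] abc by (simp add: in_pattern_444 Collect_disj_eq)
    moreover have "V 1 4 2 + V 3 4 2 = 1"
      using sums(1)[of 4 2] abc by (simp add: in_pattern_444 Collect_disj_eq)
    moreover have "V 3 1 2 + V 3 4 2 = 1"
      using sums(2)[of 3 2] abc by (simp add: in_pattern_444 Collect_disj_eq)
    moreover have "V 3 1 2 + V 3 1 4 = 1"
      using sums(3)[of 3 1] abc by (simp add: in_pattern_444 Collect_disj_eq)
    moreover have "V 3 1 4 + V 3 2 4 + V 3 4 4 = 1"
      using sums(2)[of 3 4] abc by (simp add: in_pattern_444 Collect_disj_eq)
    moreover have "V 1 2 4 + V 3 2 4 = 1"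
      using sums(1)[of 2 4] abc by (simp add: in_pattern_444 Collect_disj_eq)
    ultimately show ?thesis by linarith
  qed
  moreover have "V 1 2 3 + V 1 2 4 = 1"
    using sums(3)[of 1 2] abc by (simp add: in_pattern_444 Collect_disj_eq)
  ultimately show False by presburger
qed

section \<open>The theorem\<close>

theorem theorem9:
  fixes n :: nat and r :: "nat \<Rightarrow> nat"
  assumes "\<And>j k. 1 \<le> j \<Longrightarrow> j \<le> k \<Longrightarrow> k \<le> n \<Longrightarrow> r j \<ge> r k"
    and "\<And>k. k \<in> {1..n} \<Longrightarrow> r k \<ge> 2"
    and "(n \<ge> 4 \<and> r 3 \<ge> 3) \<or>
         (n = 3 \<and> r 3 \<ge> 4) \<or>
         (n = 3 \<and> r 3 = 3 \<and> r 1 \<ge> 6 \<and> r 2 \<ge> 4)"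
  shows "\<not> very_ample (no_way_config n r) \<and>
         \<not> very_ample_ring (semigroup_ring (no_way_config n r)
              :: (((nat \<times> (nat \<Rightarrow> nat)) \<Rightarrow>\<^sub>0 nat) \<Rightarrow>\<^sub>0 'k::field) set)"
proof -
  have n: "n \<ge> 3" using assms(3) by auto
  have mono: "r 2 \<ge> r 3" "r 1 \<ge> r 2" using assms(1)[of 2 3] assms(1)[of 1 2] n by auto
  have "\<not> very_ample (no_way_config n r)"
    using assms(3)
  proof (elim disjE conjE)
    assume case_a: "n \<ge> 4" "r 3 \<ge> 3"
    then have r: "r 1 \<ge> 3" "r 2 \<ge> 3" using mono by auto
    show ?thesis
    proof (rule not_very_ample_if_no_half_table[OF n assms(2)])
      show "pattern_333 \<subseteq> {1..r 1} \<times> {1..r 2} \<times> {1..r 3}"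
        using case_a r by (auto simp: pattern_333_def)
      show "(1, 2, 1) \<in> pattern_333" by (simp add: in_pattern_333)
    qed (use no_half_table_333[OF r case_a(2)] case_a(1) in blast | rule even_pattern_333 | assumption)+
  next
    assume case_b: "n = 3" "r 3 \<ge> 4"
    then have r: "r 1 \<ge> 4" "r 2 \<ge> 4" using mono by auto
    show ?thesis
    proof (rule not_very_ample_if_no_half_table[OF n assms(2)])
      show "pattern_444 \<subseteq> {1..r 1} \<times> {1..r 2} \<times> {1..r 3}"
        using case_b r by (auto simp: pattern_444_def)
      show "(2, 1, 3) \<in> pattern_444" by (simp add: in_pattern_444)
    qed (use no_half_table_444[OF r case_b(2)] in blast | rule even_pattern_444 | assumption)+
  next
    assume case_c: "n = 3" "r 3 = 3" "r 1 \<ge> 6" "r 2 \<ge> 4"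
    then have r: "r 3 \<ge> 3" by simp
    show ?thesis
    proof (rule not_very_ample_if_no_half_table[OF n assms(2)])
      show "pattern_643 \<subseteq> {1..r 1} \<times> {1..r 2} \<times> {1..r 3}"
        using case_c by (auto simp: pattern_643_def)
      show "(2, 4, 2) \<in> pattern_643" by (simp add: in_pattern_643)
    qed (use no_half_table_643[OF case_c(3,4) r] in blast | rule even_pattern_643 | assumption)+
  qed
  moreover have "finite (no_way_config n r)"
    unfolding no_way_config_eq by (intro finite_imageI finite_box)
  ultimately show ?thesis using very_ample_ring_semigroup_ring by blast
qed

end
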